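(* Let $B=\mathbb R^m$, $T=\mathbb R^p$, $C=\mathbb R^q$, $R=\mathbb R^r$, $Y=\mathbb R^\ell$ with Euclidean norms, and let $A_T:B\to T$, $A_C:B\to C$, $A_R:B\to R$, $G:B\to Y$, $H:Y\to\mathbb R^d$, $K:R\to\mathbb R^d$ be linear maps. Assume $G$ is injective and $H$ is injective on $G(B)$. Define $$\lambda_G:=\inf_{\|b\|=1}\|Gb\|>0,\qquad \mu_H:=\inf_{y\in G(B),\,\|y\|=1}\|Hy\|>0.$$ Let $\mathcal A_N^{\det}:=\{(b,A_Tb,A_Cb,A_Rb):b\in B\}\subset B\oplus T\oplus C\oplus R$ and $\Gamma_N=\{0\}$. For $D=(b,A_Tb,A_Cb,A_Rb)$ define $$\operatorname{dist}_0(D,\Gamma_N):=\|b\|,\quad \operatorname{dist}_{\mathrm{comp}}(D,\Gamma_N):=\|(b,A_Tb,A_Cb,A_Rb)\|,\quad \mathsf{Err}_N(D):=\|A_Rb\|,$$ $$\Theta_N(D):=Gb,\quad \operatorname{dist}_{\mathrm{cl}}(\Theta_ND,0):=\|Gb\|,\quad M_N^{\mathrm{comp}}(\Theta_ND):=\|HGb\|,\quad M_N^{\mathrm{loc}}(D):=\|HGb+KA_Rb\|.$$ Then for every $D\in\mathcal A_N^{\det}$: (a) $M_N^{\mathrm{comp}}(\Theta_ND)\ge\mu_H\operatorname{dist}_{\mathrm{cl}}(\Theta_ND,0)$; (b) $\operatorname{dist}_{\mathrm{cl}}(\Theta_ND,0)\ge\lambda_G\operatorname{dist}_0(D,\Gamma_N)$;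 (c) $\operatorname{dist}_{\mathrm{comp}}(D,\Gamma_N)\le C^N_{\mathrm{comp}/0}\operatorname{dist}_0(D,\Gamma_N)$ with $C^N_{\mathrm{comp}/0}:=(1+\|A_T\|^2+\|A_C\|^2+\|A_R\|^2)^{1/2}$; (d) $\mathsf{Err}_N(D)\le\operatorname{dist}_{\mathrm{comp}}(D,\Gamma_N)$; (e) $M_N^{\mathrm{loc}}(D)\ge M_N^{\mathrm{comp}}(\Theta_ND)-\|K\|\mathsf{Err}_N(D)$. Consequently, if $c_N:=\mu_H\lambda_G-\|K\|C^N_{\mathrm{comp}/0}>0$, then $M_N^{\mathrm{loc}}(D)\ge c_N\operatorname{dist}_0(D,\Gamma_N)$ for every $D\in\mathcal A_N^{\det}$. In particular, in that case, $M_N^{\mathrm{loc}}(D)=0$ forces $D\in\Gamma_N$ on $\mathcal A_N^{\det}$.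
   Context: Norms of linear maps are operator norms; the norm on the direct sum $B\oplus T\oplus C\oplus R$ is Euclidean. *)

theory Defs
  imports "HOL-Analysis.Analysis"
begin

text \<open>
  The spaces are \<^typ>\<open>real^'n\<close> for finite index types; \<^const>\<open>onorm\<close> is the operator norm for
  Euclidean norms. The direct sum of \<open>B\<close>, \<open>T\<close>, \<open>C\<close>, \<open>R\<close> is the product type, whose library
  norm is the Euclidean one.
\<close>

type_synonym ('m, 'p, 'q, 'r) state = "(real^'m) \<times> (real^'p) \<times> (real^'q) \<times> (real^'r)"

definition lambda_G :: "(real^'m \<Rightarrow> real^'l) \<Rightarrow> real" where
  "lambda_G G = (INF b\<in>{b. norm b = 1}. norm (G b))"

definition mu_H :: "(real^'m \<Rightarrow> real^'l) \<Rightarrow> (real^'l \<Rightarrow> real^'d) \<Rightarrow> real" where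
  "mu_H G H = (INF y\<in>{y \<in> range G. norm y = 1}. norm (H y))"

definition A_det :: "(real^'m \<Rightarrow> real^'p) \<Rightarrow> (real^'m \<Rightarrow> real^'q) \<Rightarrow> (real^'m \<Rightarrow> real^'r)
    \<Rightarrow> ('m, 'p, 'q, 'r) state set" where
  "A_det A_T A_C A_R = {(b, A_T b, A_C b, A_R b) | b. True}"

definition Gamma_N :: "('m::finite, 'p::finite, 'q::finite, 'r::finite) state set" where
  "Gamma_N = {0}"

text \<open>
  The following quantities are only meant for \<open>D = (b, A_T b, A_C b, A_R b)\<close>, where \<open>b\<close> is
  recovered as \<open>fst D\<close>. The distances \<open>dist_0\<close>, \<open>dist_comp\<close> are those to \<^const>\<open>Gamma_N\<close>,
  and \<open>dist_cl\<close> is the distance to \<open>0\<close>.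
\<close>

definition dist_0 :: "('m::finite, 'p::finite, 'q::finite, 'r::finite) state \<Rightarrow> real" where
  "dist_0 D = norm (fst D)"

definition dist_comp :: "(real^'m \<Rightarrow> real^'p) \<Rightarrow> (real^'m \<Rightarrow> real^'q) \<Rightarrow> (real^'m \<Rightarrow> real^'r)
    \<Rightarrow> ('m, 'p, 'q, 'r) state \<Rightarrow> real" where
  "dist_comp A_T A_C A_R D = (let b = fst D in norm (b, A_T b, A_C b, A_R b))"

definition Err :: "(real^'m \<Rightarrow> real^'r)
    \<Rightarrow> ('m, 'p::finite, 'q::finite, 'r) state \<Rightarrow> real" where
  "Err A_R D = norm (A_R (fst D))"

definition Theta :: "(real^'m \<Rightarrow> real^'l) \<Rightarrow> ('m, 'p::finite, 'q::finite, 'r::finite) state \<Rightarrow> real^'l" where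
  "Theta G D = G (fst D)"

definition dist_cl :: "real^'l \<Rightarrow> real" where
  "dist_cl y = norm y"

definition M_comp :: "(real^'l \<Rightarrow> real^'d) \<Rightarrow> real^'l \<Rightarrow> real" where
  "M_comp H y = norm (H y)"

definition M_loc :: "(real^'m \<Rightarrow> real^'r) \<Rightarrow> (real^'m \<Rightarrow> real^'l) \<Rightarrow> (real^'l \<Rightarrow> real^'d)
    \<Rightarrow> (real^'r \<Rightarrow> real^'d) \<Rightarrow> ('m, 'p::finite, 'q::finite, 'r) state \<Rightarrow> real" where
  "M_loc A_R G H K D = (let b = fst D in norm (H (G b) + K (A_R b)))"

definition C_comp0 :: "(real^'m \<Rightarrow> real^'p) \<Rightarrow> (real^'m \<Rightarrow> real^'q) \<Rightarrow> (real^'m \<Rightarrow> real^'r)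
    \<Rightarrow> real" where
  "C_comp0 A_T A_C A_R = sqrt (1 + (onorm A_T)\<^sup>2 + (onorm A_C)\<^sup>2 + (onorm A_R)\<^sup>2)"

definition c_N :: "(real^'m \<Rightarrow> real^'p) \<Rightarrow> (real^'m \<Rightarrow> real^'q) \<Rightarrow> (real^'m \<Rightarrow> real^'r)
    \<Rightarrow> (real^'m \<Rightarrow> real^'l) \<Rightarrow> (real^'l \<Rightarrow> real^'d) \<Rightarrow> (real^'r \<Rightarrow> real^'d) \<Rightarrow> real" where
  "c_N A_T A_C A_R G H K = mu_H G H * lambda_G G - onorm K * C_comp0 A_T A_C A_R"

end

theory Submission imports Defs begin

text \<open>
  On a subspace of a Euclidean space the norm of an injective linear map attains a positive minimum
  on the compact unit sphere; by homogeneity this gives the lower bounds for \<open>G\<close> and for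
  \<open>H\<close> on \<open>G(B)\<close>. Everything else is the triangle inequality: the term \<open>K A_R b\<close> costs at most
  \<open>\<parallel>K\<parallel> \<parallel>A_R b\<parallel>\<close>, and \<open>\<parallel>A_R b\<parallel>\<close> is dominated by the norm of the graph point over \<open>b\<close>.
\<close>

text \<open>The subspace is a parameter so that \<open>lambda_G\<close> and \<open>mu_H\<close>
  become two instances, \<open>S = UNIV\<close> and \<open>S = range G\<close>.\<close>

definition min_stretch :: "('a::real_normed_vector \<Rightarrow> 'b::real_normed_vector) \<Rightarrow> 'a set \<Rightarrow> real" where
  "min_stretch f S = (INF x\<in>{x \<in> S. norm x = 1}. norm (f x))"

lemma min_stretch_bound:
  assumes "linear f" and "subspace S" and "x \<in> S"
  shows "min_stretch f S * norm x \<le> norm (f x)"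
proof (cases "x = 0")
  case True
  then show ?thesis by simp
next
  case False
  let ?u = "x /\<^sub>R norm x"
  have "?u \<in> {x \<in> S. norm x = 1}"
    using assms(2,3) False by (simp add: subspace_scale)
  moreover have "bdd_below ((\<lambda>x. norm (f x)) ` {x \<in> S. norm x = 1})"
    by (rule bdd_belowI2[of _ 0]) simp
  ultimately have "min_stretch f S \<le> norm (f ?u)"
    unfolding min_stretch_def by (rule cINF_lower[rotated])
  also have "\<dots> = norm (f x) / norm x"
    using assms(1) by (simp add: linear_scale divide_inverse mult.commute)
  finally show ?thesis
    using False by (simp add: pos_le_divide_eq)
qed

text \<open>\<open>S \<noteq> {0}\<close> guarantees a unit vector in \<open>S\<close>; otherwise
  the infimum would range over the empty set.\<close>

lemma min_stretch_pos:
  fixes f :: "'a::euclidean_space \<Rightarrow> 'b::real_normed_vector"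
  assumes "linear f" and "subspace S" and "inj_on f S" and "S \<noteq> {0}"
  shows "min_stretch f S > 0"
proof -
  let ?U = "{x \<in> S. norm x = 1}"
  have "?U = S \<inter> sphere 0 1" by auto
  \<comment> \<open>Subspaces of a Euclidean space are closed, so \<open>?U\<close> is a closed part
    of a compact sphere.\<close>
  then have "compact ?U"
    using assms(2) by (simp add: closed_Int_compact closed_subspace)
  obtain x where "x \<in> S" "x \<noteq> 0"
    using assms(2,4) subspace_0 by blast
  then have "x /\<^sub>R norm x \<in> ?U"
    using assms(2) by (simp add: subspace_scale)
  then have "?U \<noteq> {}" by blast
  have "continuous_on ?U (\<lambda>x. norm (f x))"
    using assms(1) by (intro continuous_intros linear_continuous_on_compose[OF continuous_on_id])
  then obtain u where u: "u \<in> ?U" and min: "\<forall>x\<in>?U. norm (f u) \<le> norm (f x)"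
    using continuous_attains_inf \<open>compact ?U\<close> \<open>?U \<noteq> {}\<close> by blast
  have "u \<noteq> 0" using u by auto
  then have "f u \<noteq> 0"
    using u assms(1-3) linear_injective_on_subspace_0 by blast
  then have "0 < norm (f u)" by simp
  also have "norm (f u) \<le> min_stretch f S"
    unfolding min_stretch_def using \<open>?U \<noteq> {}\<close> min by (intro cINF_greatest) auto
  finally show ?thesis .
qed

lemma lambda_G_eq: "lambda_G G = min_stretch G UNIV"
  by (simp add: lambda_G_def min_stretch_def)

lemma mu_H_eq: "mu_H G H = min_stretch H (range G)"
  by (simp add: mu_H_def min_stretch_def)

text \<open>Squares of the component norms add up in the product norm, and each linear map
  contributes at most its squared operator norm; the 1 comes from the component \<open>x\<close>
  itself.\<close>

lemma norm_graph_bound: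
  assumes "bounded_linear f" and "bounded_linear g" and "bounded_linear h"
  shows "norm (x, f x, g x, h x)
    \<le> sqrt (1 + (onorm f)\<^sup>2 + (onorm g)\<^sup>2 + (onorm h)\<^sup>2) * norm x"
proof -
  have le: "(norm (k x))\<^sup>2 \<le> (onorm k)\<^sup>2 * (norm x)\<^sup>2" if "bounded_linear k" for k :: "'a \<Rightarrow> 'z::real_normed_vector"
    using power_mono[OF onorm[OF that, of x] norm_ge_zero, of 2] by (simp add: power_mult_distrib)
  have "norm (x, f x, g x, h x)
      = sqrt ((norm x)\<^sup>2 + (norm (f x))\<^sup>2 + (norm (g x))\<^sup>2 + (norm (h x))\<^sup>2)"
    by (simp add: norm_Pair add.assoc)
  also have "\<dots> \<le> sqrt ((1 + (onorm f)\<^sup>2 + (onorm g)\<^sup>2 + (onorm h)\<^sup>2) * (norm x)\<^sup>2)"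
    using le[OF assms(1)] le[OF assms(2)] le[OF assms(3)]
    by (intro real_sqrt_le_mono) (simp add: algebra_simps)
  finally show ?thesis
    by (simp add: real_sqrt_mult)
qed

lemma norm_le_graph: "norm (h x) \<le> norm (x, f x, g x, h x)"
  using norm_snd_le[of "h x" "g x"] norm_snd_le[of "(g x, h x)" "f x"]
    norm_snd_le[of "(f x, g x, h x)" x] by linarith

theorem theorem9p8:
  fixes A_T :: "real^'m \<Rightarrow> real^'p"
    and A_C :: "real^'m \<Rightarrow> real^'q"
    and A_R :: "real^'m \<Rightarrow> real^'r"
    and G :: "real^'m \<Rightarrow> real^'l"
    and H :: "real^'l \<Rightarrow> real^'d"
    and K :: "real^'r \<Rightarrow> real^'d"
  assumes "linear A_T" and "linear A_C" and "linear A_R"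
    and "linear G" and "linear H" and "linear K"
    and "inj G" and "inj_on H (range G)"
  shows "lambda_G G > 0 \<and> mu_H G H > 0 \<and>
    (\<forall>D\<in>A_det A_T A_C A_R.
        M_comp H (Theta G D) \<ge> mu_H G H * dist_cl (Theta G D)
      \<and> dist_cl (Theta G D) \<ge> lambda_G G * dist_0 D
      \<and> dist_comp A_T A_C A_R D \<le> C_comp0 A_T A_C A_R * dist_0 D
      \<and> Err A_R D \<le> dist_comp A_T A_C A_R D
      \<and> M_loc A_R G H K D \<ge> M_comp H (Theta G D) - onorm K * Err A_R D) \<and>
    (c_N A_T A_C A_R G H K > 0 \<longrightarrow>
        (\<forall>D\<in>A_det A_T A_C A_R. M_loc A_R G H K D \<ge> c_N A_T A_C A_R G H K * dist_0 D)
      \<and> (\<forall>D\<in>A_det A_T A_C A_R. M_loc A_R G H K D = 0 \<longrightarrow> D \<in> Gamma_N))"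
proof -
  have bl: "bounded_linear A_T" "bounded_linear A_C" "bounded_linear A_R" "bounded_linear K"
    using assms by (simp_all add: linear_conv_bounded_linear)
  have sub: "subspace (range G)"
    using linear_subspace_image[OF \<open>linear G\<close> subspace_UNIV] .
  \<comment> \<open>Index types are inhabited, so \<open>B\<close> is nontrivial: the all-ones
    vector \<open>1\<close> is nonzero, and injectivity carries this over to
    \<open>range G\<close>.\<close>
  have neU: "(UNIV :: (real^'m) set) \<noteq> {0}"
    using zero_neq_one by blast
  have "G 1 \<noteq> 0"
    using \<open>linear G\<close> \<open>inj G\<close> by (metis inj_eq linear_0 zero_neq_one)
  then have ne: "range G \<noteq> {0}"
    by blast
  have lambda: "lambda_G G > 0"
    unfolding lambda_G_eq using min_stretch_pos[OF \<open>linear G\<close> subspace_UNIV \<open>inj G\<close> neU] .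
  have mu: "mu_H G H > 0"
    unfolding mu_H_eq using min_stretch_pos[OF \<open>linear H\<close> sub \<open>inj_on H (range G)\<close> ne] .
  \<comment> \<open>Points of \<open>A_det\<close> are parametrised by \<open>b\<close>, so
    \<open>a\<close> to \<open>e\<close> are the five claims stated for the base vector
    alone.\<close>
  have a: "mu_H G H * norm (G b) \<le> norm (H (G b))" for b
    unfolding mu_H_eq using min_stretch_bound[OF \<open>linear H\<close> sub] by blast
  have b: "lambda_G G * norm b \<le> norm (G b)" for b
    unfolding lambda_G_eq using min_stretch_bound[OF \<open>linear G\<close> subspace_UNIV] by blast
  have c: "norm (b, A_T b, A_C b, A_R b) \<le> C_comp0 A_T A_C A_R * norm b" for b
    unfolding C_comp0_def using norm_graph_bound[OF bl(1-3)] .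
  have d: "norm (A_R b) \<le> norm (b, A_T b, A_C b, A_R b)" for b
    by (rule norm_le_graph)
  have e: "norm (H (G b)) - onorm K * norm (A_R b) \<le> norm (H (G b) + K (A_R b))" for b
    using onorm[OF bl(4), of "A_R b"] norm_diff_ineq[of "H (G b)" "K (A_R b)"] by linarith
  \<comment> \<open>Chaining \<open>a\<close> with \<open>b\<close> bounds the main term from below,
    as \<open>mu_H G H\<close> is positive; chaining \<open>d\<close> with \<open>c\<close> bounds
    the error, as \<open>onorm K\<close> is nonnegative. Then \<open>e\<close> subtracts the
    two.\<close>
  have coercive: "c_N A_T A_C A_R G H K * norm b \<le> norm (H (G b) + K (A_R b))" for b
  proof -
    have "mu_H G H * (lambda_G G * norm b) \<le> norm (H (G b))"
      using mult_left_mono[OF b[of b], of "mu_H G H"] mu a[of b] by linarith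
    moreover have "onorm K * norm (A_R b) \<le> onorm K * (C_comp0 A_T A_C A_R * norm b)"
      using c[of b] d[of b] onorm_pos_le[OF bl(4)] by (intro mult_left_mono) linarith+
    ultimately show ?thesis
      using e[of b] by (simp add: c_N_def algebra_simps)
  qed
  have zero: "(b, A_T b, A_C b, A_R b) = 0"
    if "c_N A_T A_C A_R G H K > 0" "H (G b) + K (A_R b) = 0" for b
  proof -
    \<comment> \<open>Coercivity leaves a product of the positive constant and \<open>norm b\<close>
      that is at most 0.\<close>
    have "b = 0"
      using coercive[of b] that by (simp add: mult_le_0_iff)
    then show ?thesis
      using assms(1-3) by (simp add: linear_0 zero_prod_def)
  qed
  show ?thesis
    using lambda mu a b c d e coercive zero
    by (auto simp: A_det_def Gamma_N_def dist_0_def dist_comp_def Err_def Theta_def dist_cl_def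
        M_comp_def M_loc_def)
qed

end
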